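(* The statistics $AR$, $LM$, $LR$ and $QLR$ defined in the context are invariant to every $g=(g_1,g_2)\in\mathcal G_L(k)\times\mathcal G_T(2)$, i.e. each of them takes the same value at $(R_0,\Sigma_0)$ and at $g\circ(R_0,\Sigma_0)=(g_1R_0g_2',(g_2\otimes g_1)\Sigma_0(g_2'\otimes g_1'))$.
   Context: Data: $R_0=[R_1:R_2]$ is a real $k\times2$ matrix and $\Sigma_0$ a positive definite $2k\times2k$ matrix (the model is $\mathrm{vec}(R_0)\sim N(a_\Delta\otimes\mu,\Sigma_0)$ with $a_\Delta=(\Delta,1)'$, null hypothesis $\Delta=0$). Partition $\Sigma_0$ into $k\times k$ blocks $\Sigma_{ij}$ and $\Sigma_0^{-1}$ into $k\times k$ blocks $\Sigma^{ij}$. Define $S=\Sigma_{11}^{-1/2}R_1$ and $T=(\Sigma^{22})^{-1/2}[\Sigma^{21}:\Sigma^{22}]\,\mathrm{vec}(R_0)$ (symmetric square roots). For a matrix $A$ of full column rank, $N_A=A(A'A)^{-1}A'$. Statistics (for $LM$ and $QLR$, with $T\ne0$): $AR=S'S$; $LM=S'N_{CD^{-1}T}S$ with $C=\Sigma_{11}^{-1/2}$ and $D=(\Sigma^{22})^{1/2}$; $QLR=\frac12\big(AR-r(T)+\sqrt{(AR-r(T))^2+4\,LM\cdot r(T)}\big)$ with $r(T)=T'T$; $LR=\sup_{\Delta\in\mathbb R}\ \mathrm{vec}(R_0)'\Sigma_0^{-1/2}N_{\Sigma_0^{-1/2}(a_\Delta\otimes I_k)}\Sigma_0^{-1/2}\mathrm{vec}(R_0)-T'T$.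 $\mathcal G_L(k)$ is the group of invertible $k\times k$ real matrices; $\mathcal G_T(2)$ the group of invertible lower triangular $2\times2$ real matrices. *)

theory Defs
  imports "HOL-Analysis.Analysis"
begin

definition positive_definite :: "real^'n^'n \<Rightarrow> bool" where
  "positive_definite A \<longleftrightarrow> transpose A = A \<and> (\<forall>x. x \<noteq> 0 \<longrightarrow> x \<bullet> (A *v x) > 0)"

text \<open>The symmetric positive semidefinite square root. It exists and is unique for
  symmetric positive semidefinite \<open>A\<close>; it is only applied to positive definite matrices
  below.\<close>

definition mat_sqrt :: "real^'n^'n \<Rightarrow> real^'n^'n" where
  "mat_sqrt A =
     (THE B. transpose B = B \<and> (\<forall>x. x \<bullet> (B *v x) \<ge> 0) \<and> B ** B = A)"

definition mat_inv_sqrt :: "real^'n^'n \<Rightarrow> real^'n^'n" where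
  "mat_inv_sqrt A = matrix_inv (mat_sqrt A)"

text \<open>The matrix \<open>N\<^sub>A = A (A' A)\<^sup>-\<^sup>1 A'\<close>. Meaningful only if \<open>A\<close> has full column rank.\<close>

definition proj_mat :: "real^'m^'n \<Rightarrow> real^'n^'n" where
  "proj_mat A = A ** matrix_inv (transpose A ** A) ** transpose A"

text \<open>A \<open>2k\<close>-dimensional index is a pair (block, position within the block), so that
  \<open>real^(2 \<times> 'k)\<close> plays the role of the \<open>2k\<close>-vectors with \<open>k = CARD('k)\<close>. Stacking the
  columns of a matrix, the Kronecker product and the partition into \<open>k \<times> k\<close> blocks all
  use this indexing.\<close>

definition vectorize :: "real^'m^'n \<Rightarrow> real^('m \<times> 'n)" where
  "vectorize A = (\<chi> p. A $ snd p $ fst p)"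

definition kron :: "real^'b^'a \<Rightarrow> real^'d^'c \<Rightarrow> real^('b \<times> 'd)^('a \<times> 'c)"
    (infixl "\<otimes>\<^sub>K" 70) where
  "A \<otimes>\<^sub>K B = (\<chi> p q. A $ fst p $ fst q * B $ snd p $ snd q)"

definition block :: "2 \<Rightarrow> 2 \<Rightarrow> real^(2 \<times> 'k)^(2 \<times> 'k) \<Rightarrow> real^'k^'k" where
  "block i j M = (\<chi> p q. M $ (i, p) $ (j, q))"

definition hconcat :: "real^'k^'m \<Rightarrow> real^'k^'m \<Rightarrow> real^(2 \<times> 'k)^'m" where
  "hconcat A B = (\<chi> p q. if fst q = 1 then A $ p $ snd q else B $ p $ snd q)"

type_synonym 'k data = "(real^2^'k) \<times> (real^(2 \<times> 'k)^(2 \<times> 'k))"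

definition a_vec :: "real \<Rightarrow> real^2" where
  "a_vec \<Delta> = vector [\<Delta>, 1]"

fun S_vec :: "'k::finite data \<Rightarrow> real^'k" where
  "S_vec (R, \<Sigma>) = mat_inv_sqrt (block 1 1 \<Sigma>) *v column 1 R"

fun T_vec :: "'k::finite data \<Rightarrow> real^'k" where
  "T_vec (R, \<Sigma>) =
     mat_inv_sqrt (block 2 2 (matrix_inv \<Sigma>)) *v
       (hconcat (block 2 1 (matrix_inv \<Sigma>)) (block 2 2 (matrix_inv \<Sigma>)) *v vectorize R)"

fun C_mat :: "'k::finite data \<Rightarrow> real^'k^'k" where
  "C_mat (R, \<Sigma>) = mat_inv_sqrt (block 1 1 \<Sigma>)"

fun D_mat :: "'k::finite data \<Rightarrow> real^'k^'k" where
  "D_mat (R, \<Sigma>) = mat_sqrt (block 2 2 (matrix_inv \<Sigma>))"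

definition AR_stat :: "'k::finite data \<Rightarrow> real" where
  "AR_stat d = S_vec d \<bullet> S_vec d"

definition rT :: "'k::finite data \<Rightarrow> real" where
  "rT d = T_vec d \<bullet> T_vec d"

text \<open>Meaningful only if \<open>T_vec d \<noteq> 0\<close>, and likewise \<open>QLR_stat\<close>.\<close>

definition LM_stat :: "'k::finite data \<Rightarrow> real" where
  "LM_stat d = S_vec d \<bullet>
     (proj_mat (columnvector (C_mat d *v (matrix_inv (D_mat d) *v T_vec d)) :: real^1^'k)
        *v S_vec d)"

definition QLR_stat :: "'k::finite data \<Rightarrow> real" where
  "QLR_stat d = 1/2 * (AR_stat d - rT d + sqrt ((AR_stat d - rT d)\<^sup>2 + 4 * LM_stat d * rT d))"

text \<open>The supremum is that of a bounded set of reals for positive definite \<open>\<Sigma>\<close>, because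
  \<open>proj_mat\<close> is then an orthogonal projection.\<close>

fun LR_stat :: "'k::finite data \<Rightarrow> real" where
  "LR_stat (R, \<Sigma>) =
     (SUP \<Delta>. vectorize R \<bullet>
        (mat_inv_sqrt \<Sigma> *v
          (proj_mat (mat_inv_sqrt \<Sigma> **
               ((columnvector (a_vec \<Delta>) :: real^1^2) \<otimes>\<^sub>K (mat 1 :: real^'k^'k))) *v
            (mat_inv_sqrt \<Sigma> *v vectorize R))))
     - T_vec (R, \<Sigma>) \<bullet> T_vec (R, \<Sigma>)"

definition GL :: "(real^'k^'k) set" where
  "GL = {A. invertible A}"

definition GT2 :: "(real^2^2) set" where
  "GT2 = {A. invertible A \<and> A $ 1 $ 2 = 0}"

fun act :: "(real^'k^'k) \<times> (real^2^2) \<Rightarrow> 'k::finite data \<Rightarrow> 'k data" where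
  "act (g1, g2) (R, \<Sigma>) =
     (g1 ** R ** transpose g2,
      (g2 \<otimes>\<^sub>K g1) ** \<Sigma> ** (transpose g2 \<otimes>\<^sub>K transpose g1))"

end

theory Submission
  imports Defs
begin

text \<open>With \<open>Q = \<Sigma>\<^sup>-\<^sup>1\<close> and \<open>v = vec R\<close>, every statistic can be written without square roots.
  Let \<open>u\<close> be the second block of \<open>Q v\<close> and \<open>t = (\<Sigma>\<^sup>2\<^sup>2)\<^sup>-\<^sup>1 u\<close>. Then
  \<open>AR = R\<^sub>1' \<Sigma>\<^sub>1\<^sub>1\<^sup>-\<^sup>1 R\<^sub>1\<close>, \<open>T'T = u' t\<close>,
  \<open>LM = (R\<^sub>1' \<Sigma>\<^sub>1\<^sub>1\<^sup>-\<^sup>1 t)\<^sup>2 / (t' \<Sigma>\<^sub>1\<^sub>1\<^sup>-\<^sup>1 t)\<close>, and \<open>LR + T'T\<close> is the supremum of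
  \<open>2 v' Q p - p' Q p\<close> over all rank-one tensors \<open>p = x \<otimes> y\<close>. An element \<open>(G, h)\<close> of the group
  acts by \<open>K = h \<otimes> G\<close>, which permutes the rank-one tensors. As \<open>h\<close> is lower triangular,
  \<open>K'\<close> preserves the first block and \<open>K\<close> the second one, so that \<open>R\<^sub>1, \<Sigma>\<^sub>1\<^sub>1\<close> and \<open>u, \<Sigma>\<^sup>2\<^sup>2\<close>
  change by congruences and \<open>t\<close> changes by a multiple of the congruence acting on \<open>R\<^sub>1\<close>.\<close>

section \<open>Square roots of positive definite matrices\<close>

text \<open>Moving from \<open>x\<close> in direction \<open>- f x\<close> changes the form by
  \<open>- 2 * t * a\<close> to first order in \<open>t\<close>, so nonnegativity on
  \<open>S\<close> fails for small \<open>t > 0\<close> unless \<open>f x = 0\<close>.\<close>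

lemma nonneg_form_zero_imp:
  fixes f :: "'a::euclidean_space \<Rightarrow> 'a"
  assumes f: "linear f" and sa: "\<And>x y. f x \<bullet> y = x \<bullet> f y"
    and S: "subspace S" and nn: "\<And>y. y \<in> S \<Longrightarrow> 0 \<le> y \<bullet> f y"
    and x: "x \<in> S" "x \<bullet> f x = 0" and fx: "f x \<in> S"
  shows "f x = 0"
proof (rule ccontr)
  assume "f x \<noteq> 0"
  define a b where "a = f x \<bullet> f x" and "b = f x \<bullet> f (f x)"
  have a: "a > 0" using \<open>f x \<noteq> 0\<close> by (simp add: a_def)
  have b: "b \<ge> 0" using nn[OF fx] by (simp add: b_def)
  have *: "0 \<le> - 2 * t * a + t\<^sup>2 * b" for t
  proof -
    have "0 \<le> (x - t *\<^sub>R f x) \<bullet> f (x - t *\<^sub>R f x)"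
      by (intro nn subspace_diff subspace_scale S x fx)
    also have "\<dots> = - 2 * t * a + t\<^sup>2 * b"
      using x sa[of x "f x"]
      by (simp add: linear_diff[OF f] linear_scale[OF f] inner_diff a_def b_def power2_eq_square
          algebra_simps)
    finally show ?thesis .
  qed
  \<comment> \<open>The value \<open>a / (b + 1)\<close> is close to the minimiser
    \<open>a / b\<close>, but stays defined when \<open>b = 0\<close>.\<close>
  have "- 2 * (a / (b + 1)) * a + (a / (b + 1))\<^sup>2 * b = - (a / (b+1))\<^sup>2 * (b + 2)"
    using b by (simp add: divide_simps power2_eq_square) (simp add: algebra_simps)
  also have "\<dots> < 0" using a b by (simp add: mult_neg_pos)
  finally show False using *[of "a / (b+1)"] by linarith
qed

text \<open>A maximiser \<open>x\<close> of the Rayleigh quotient on the unit sphere of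
  \<open>S\<close> works: with \<open>c\<close> the maximum, the form of \<open>c - f\<close> is
  nonnegative on \<open>S\<close> and vanishes at \<open>x\<close>.\<close>

lemma self_adjoint_eigenvector:
  fixes f :: "'a::euclidean_space \<Rightarrow> 'a"
  assumes f: "linear f" and sa: "\<And>x y. f x \<bullet> y = x \<bullet> f y"
    and S: "subspace S" and inv: "\<And>x. x \<in> S \<Longrightarrow> f x \<in> S" and ne: "S \<noteq> {0}"
  obtains x c where "x \<in> S" "norm x = 1" "f x = c *\<^sub>R x"
proof -
  obtain z where z: "z \<in> S" "z \<noteq> 0" using ne subspace_0[OF S] by blast
  have "(1 / norm z) *\<^sub>R z \<in> S \<inter> sphere 0 1"
    using z by (auto intro: subspace_scale[OF S])
  moreover have "compact (S \<inter> sphere 0 1)"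
    by (simp add: closed_Int_compact closed_subspace S)
  moreover have "continuous_on (S \<inter> sphere 0 1) (\<lambda>x. x \<bullet> f x)"
    by (intro continuous_intros linear_continuous_on linear_linear[THEN iffD2] f)
  ultimately obtain x where x: "x \<in> S" "norm x = 1"
    and max: "\<And>y. y \<in> S \<Longrightarrow> norm y = 1 \<Longrightarrow> y \<bullet> f y \<le> x \<bullet> f x"
    using continuous_attains_sup[of "S \<inter> sphere 0 1" "\<lambda>x. x \<bullet> f x"]
    by (metis (no_types, lifting) Int_iff dist_0_norm empty_iff mem_sphere)
  define c where "c = x \<bullet> f x"
  define h where "h y = c *\<^sub>R y - f y" for y
  have "h x = 0"
  proof (rule nonneg_form_zero_imp[where f=h and S=S])
    show "linear h" unfolding h_def by (intro linear_compose_sub f linear_scale_self)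
    show "h u \<bullet> v = u \<bullet> h v" for u v by (simp add: h_def inner_diff sa)
    show "0 \<le> y \<bullet> h y" if "y \<in> S" for y
    proof (cases "y = 0")
      case False
      have "((1 / norm y) *\<^sub>R y) \<bullet> f ((1 / norm y) *\<^sub>R y) \<le> c"
        unfolding c_def using False that by (intro max) (auto intro: subspace_scale[OF S])
      then have "y \<bullet> f y \<le> c * (norm y)\<^sup>2"
        using False by (simp add: linear_scale[OF f] divide_simps power2_eq_square)
      then show ?thesis by (simp add: h_def inner_diff power2_norm_eq_inner)
    qed (simp add: h_def)
    show "x \<bullet> h x = 0" using x by (simp add: h_def inner_diff c_def flip: power2_norm_eq_inner)
    show "h x \<in> S" unfolding h_def by (intro subspace_diff subspace_scale S inv x)
  qed (use x S in auto)
  then have "f x = c *\<^sub>R x" by (simp add: h_def)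
  then show thesis using x that by blast
qed

text \<open>Induction on the dimension: self-adjointness makes the orthogonal complement of an
  eigenvector within \<open>S\<close> invariant again.\<close>

lemma self_adjoint_eigenbasis_subspace:
  fixes f :: "'a::euclidean_space \<Rightarrow> 'a"
  assumes f: "linear f" and sa: "\<And>x y. f x \<bullet> y = x \<bullet> f y"
    and "subspace S" and "\<And>x. x \<in> S \<Longrightarrow> f x \<in> S"
  shows "\<exists>B. finite B \<and> pairwise orthogonal B \<and> (\<forall>b\<in>B. norm b = 1 \<and> (\<exists>c. f b = c *\<^sub>R b))
    \<and> span B = S"
  using assms(3,4)
proof (induction "dim S" arbitrary: S rule: less_induct)
  case less
  show ?case
  proof (cases "S = {0}")
    case True
    then show ?thesis by (intro exI[of _ "{}"]) auto
  next
    case False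
    obtain x c where x: "x \<in> S" "norm x = 1" "f x = c *\<^sub>R x"
      using self_adjoint_eigenvector[OF f sa less.prems False] by metis
    define S' where "S' = {y \<in> S. x \<bullet> y = 0}"
    have sub: "subspace S'"
      unfolding S'_def using less.prems(1) by (auto simp: subspace_def inner_add)
    have "x \<bullet> x = 1" using x(2) by (simp flip: power2_norm_eq_inner)
    then have "x \<notin> S'" by (simp add: S'_def)
    then have "S' \<subset> S" using x(1) by (metis (no_types, lifting) S'_def mem_Collect_eq psubsetI subsetI)
    then have "dim S' < dim S"
      using sub less.prems(1) by (intro dim_psubset) (metis span_eq_iff)
    moreover have "f y \<in> S'" if "y \<in> S'" for y
      using that less.prems(2) sa[of x y] x(3) by (auto simp: S'_def)
    ultimately obtain B where B: "finite B" "pairwise orthogonal B"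
      "\<And>b. b \<in> B \<Longrightarrow> norm b = 1 \<and> (\<exists>c. f b = c *\<^sub>R b)" "span B = S'"
      using less.hyps[OF _ sub] by blast
    have BS: "B \<subseteq> S'" using B(4) span_superset by blast
    show ?thesis
    proof (intro exI[of _ "insert x B"] conjI ballI)
      show "pairwise orthogonal (insert x B)"
        using B(2) BS by (auto simp: pairwise_insert orthogonal_def S'_def inner_commute)
      show "span (insert x B) = S"
      proof
        show "span (insert x B) \<subseteq> S"
          using BS x less.prems(1) by (intro span_minimal) (auto simp: S'_def)
        show "S \<subseteq> span (insert x B)"
        proof
          fix y assume "y \<in> S"
          then have "y - (x \<bullet> y) *\<^sub>R x \<in> span B"
            using x \<open>x \<bullet> x = 1\<close> less.prems(1)
            by (auto simp: B(4) S'_def inner_diff intro!: subspace_diff subspace_scale)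
          then show "y \<in> span (insert x B)" by (auto simp: span_insert)
        qed
      qed
    qed (use B x in auto)
  qed
qed

section \<open>Symmetric matrices: eigenbases and square roots\<close>

lemma transpose_mult_inner:
  fixes A :: "real^'n^'m"
  shows "(transpose A *v x) \<bullet> y = x \<bullet> (A *v y)"
  by (simp add: dot_lmul_matrix)

lemma symmetric_mult_inner:
  fixes A :: "real^'n^'n"
  assumes "transpose A = A"
  shows "(A *v x) \<bullet> y = x \<bullet> (A *v y)"
  by (metis assms transpose_mult_inner)

lemma symmetric_matrix_eigenbasis:
  fixes A :: "real^'n^'n"
  assumes "transpose A = A"
  obtains B where "finite B" "pairwise orthogonal B" "span B = UNIV"
    "\<forall>b\<in>B. norm b = 1" "\<forall>b\<in>B. \<exists>c. A *v b = c *\<^sub>R b"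
proof -
  show thesis
    using symmetric_mult_inner[OF assms] self_adjoint_eigenbasis_subspace[of "(*v) A" UNIV] that by auto
qed

lemma psd_sqrt_exists:
  fixes A :: "real^'n^'n"
  assumes sym: "transpose A = A" and nn: "\<And>x. x \<bullet> (A *v x) \<ge> 0"
  shows "\<exists>B. transpose B = B \<and> (\<forall>x. x \<bullet> (B *v x) \<ge> 0) \<and> B ** B = A"
proof -
  obtain E where E: "finite E" "pairwise orthogonal E" "span E = UNIV"
    "\<forall>b\<in>E. norm b = 1" and ev: "\<forall>b\<in>E. \<exists>c. A *v b = c *\<^sub>R b"
    by (rule symmetric_matrix_eigenbasis[OF sym])
  obtain l where l: "\<And>b. b \<in> E \<Longrightarrow> A *v b = l b *\<^sub>R b" using ev by metis
  have bb: "b \<bullet> b = 1" if "b \<in> E" for b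
    using E(4) that by (simp flip: power2_norm_eq_inner)
  have l0: "l b \<ge> 0" if "b \<in> E" for b
    using nn[of b] l[OF that] bb[OF that] by simp
  \<comment> \<open>The map \<open>s\<close> has the same eigenbasis as \<open>A\<close>, with each
    eigenvalue replaced by its square root.\<close>
  define s where "s v = (\<Sum>b\<in>E. (sqrt (l b) * (b \<bullet> v)) *\<^sub>R b)" for v :: "real^'n"
  have lin: "linear s"
    unfolding s_def
    by (rule linearI) (simp_all add: inner_add algebra_simps sum.distrib scaleR_sum_right)
  define B where "B = matrix s"
  have B: "B *v v = s v" for v using lin by (simp add: B_def matrix_works)
  have sa: "s x \<bullet> y = x \<bullet> s y" for x y
    by (simp add: s_def inner_sum_left inner_sum_right inner_commute mult.assoc mult.commute mult.left_commute)
  have sb: "s b = sqrt (l b) *\<^sub>R b" if "b \<in> E" for b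
  proof -
    have "s b = (\<Sum>b'\<in>E. if b' = b then sqrt (l b) *\<^sub>R b else 0)"
      unfolding s_def
    proof (rule sum.cong)
      fix b' assume "b' \<in> E"
      then show "(sqrt (l b') * (b' \<bullet> b)) *\<^sub>R b' = (if b' = b then sqrt (l b) *\<^sub>R b else 0)"
        using that E(2) bb[OF that] by (auto simp: pairwise_def orthogonal_def)
    qed simp
    then show ?thesis using E(1) that by simp
  qed
  have "transpose B = B"
  proof -
    have "(transpose B *v x) \<bullet> y = (B *v x) \<bullet> y" for x y
      using sa[of x y] by (simp add: dot_lmul_matrix B)
    then show ?thesis by (metis matrix_eq vector_eq_rdot)
  qed
  moreover have "x \<bullet> (B *v x) \<ge> 0" for x
    unfolding B s_def inner_sum_right
    by (intro sum_nonneg) (simp add: inner_commute l0 mult.assoc)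
  moreover have "B ** B = A"
  proof -
    have "B *v (B *v x) = A *v x" for x
    proof (rule linear_eq_on_span[where B=E and f="\<lambda>x. B *v (B *v x)" and g="(*v) A"])
      show "linear (\<lambda>x. B *v (B *v x))" by (simp add: matrix_vector_mul_assoc)
      show "B *v (B *v b) = A *v b" if "b \<in> E" for b
        using l[OF that] l0[OF that] by (simp add: B sb that linear_scale[OF lin])
    qed (use E in auto)
    then show ?thesis by (simp add: matrix_eq flip: matrix_vector_mul_assoc)
  qed
  ultimately show ?thesis by blast
qed

lemma psd_form_zero:
  fixes A :: "real^'n^'n"
  assumes "transpose A = A" "\<And>x. x \<bullet> (A *v x) \<ge> 0" "x \<bullet> (A *v x) = 0"
  shows "A *v x = 0"
proof (rule nonneg_form_zero_imp[where f="(*v) A" and S=UNIV])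
  show "(A *v x) \<bullet> y = x \<bullet> (A *v y)" for x y
    by (rule symmetric_mult_inner[OF assms(1)])
qed (use assms in auto)

text \<open>If \<open>B\<^sup>2 = C\<^sup>2\<close> then \<open>(B - C) B + C (B - C) = 0\<close>; evaluating this form at an eigenvector
  of \<open>B - C\<close> forces its eigenvalue to vanish.\<close>

lemma psd_sqrt_unique:
  fixes B C :: "real^'n^'n"
  assumes B: "transpose B = B" "\<And>x. x \<bullet> (B *v x) \<ge> 0"
    and C: "transpose C = C" "\<And>x. x \<bullet> (C *v x) \<ge> 0"
    and eq: "B ** B = C ** C"
  shows "B = C"
proof -
  define D where "D = B - C"
  have D: "transpose D = D" using B(1) C(1) by (simp add: D_def transpose_def vec_eq_iff)
  have Dv: "D *v x = B *v x - C *v x" for x by (simp add: D_def algebra_simps)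
  obtain E where E: "span E = UNIV" and ev: "\<forall>b\<in>E. \<exists>c. D *v b = c *\<^sub>R b"
    by (rule symmetric_matrix_eigenbasis[OF D])
  have "D *v b = 0" if "b \<in> E" for b
  proof -
    from bspec[OF ev that] obtain c where c: "D *v b = c *\<^sub>R b" ..
    have "(D *v b) \<bullet> (B *v b) + (C *v b) \<bullet> (D *v b) = 0"
    proof -
      have "(B *v b) \<bullet> (B *v b) = (C *v b) \<bullet> (C *v b)"
        using eq by (simp add: symmetric_mult_inner B C matrix_vector_mul_assoc)
      then show ?thesis by (simp add: Dv inner_diff inner_commute)
    qed
    then have "c * (b \<bullet> (B *v b) + b \<bullet> (C *v b)) = 0"
      by (simp add: c inner_commute distrib_left)
    \<comment> \<open>Both forms are nonnegative, so a vanishing sum makes each vanish; then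
      \<open>B\<close> and \<open>C\<close> both annihilate \<open>b\<close>, and so does
      \<open>D\<close>.\<close>
    then consider "c = 0" | "b \<bullet> (B *v b) = 0" "b \<bullet> (C *v b) = 0"
      using B(2)[of b] C(2)[of b] by (auto simp: add_nonneg_eq_0_iff)
    then show ?thesis
      using c by cases (simp_all add: Dv psd_form_zero[OF B] psd_form_zero[OF C])
  qed
  then have "D *v x = 0" for x
    using linear_eq_on_span[of "(*v) D" "\<lambda>_. 0" E x] E by (auto simp: linear_zero)
  then show ?thesis by (simp add: Dv matrix_eq)
qed

text \<open>Existence and uniqueness make the definite description in \<open>mat_sqrt\<close>
  denote.\<close>

lemma mat_sqrt:
  assumes "positive_definite A"
  shows transpose_mat_sqrt: "transpose (mat_sqrt A) = mat_sqrt A"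
    and mat_sqrt_square: "mat_sqrt A ** mat_sqrt A = A"
proof -
  have A: "transpose A = A" "x \<bullet> (A *v x) \<ge> 0" for x
    using assms by (auto simp: positive_definite_def less_imp_le) (metis inner_zero_left less_imp_le order_refl)
  have "\<exists>!B. transpose B = B \<and> (\<forall>x. x \<bullet> (B *v x) \<ge> 0) \<and> B ** B = A"
    using psd_sqrt_exists[OF A] psd_sqrt_unique by (metis (no_types))
  from theI'[OF this] show "transpose (mat_sqrt A) = mat_sqrt A" "mat_sqrt A ** mat_sqrt A = A"
    unfolding mat_sqrt_def by auto
qed

section \<open>Inverses and projections\<close>

lemma matrix_eq_inner:
  fixes A B :: "real^'n^'m"
  assumes "\<And>x y. x \<bullet> (A *v y) = x \<bullet> (B *v y)"
  shows "A = B"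
  using assms by (metis matrix_eq vector_eq_rdot inner_commute)

lemma matrix_inv:
  fixes A :: "real^'n^'n"
  assumes "invertible A"
  shows matrix_inv_right: "A ** matrix_inv A = mat 1"
    and matrix_inv_left: "matrix_inv A ** A = mat 1"
  using someI_ex[OF assms[unfolded invertible_def]] by (auto simp: matrix_inv_def)

lemma matrix_inv_mult_vec [simp]:
  fixes A :: "real^'n^'n"
  assumes "invertible A"
  shows "A *v (matrix_inv A *v x) = x" "matrix_inv A *v (A *v x) = x"
  by (simp_all add: matrix_vector_mul_assoc matrix_inv assms)

lemma matrix_inv_eqI:
  fixes A B :: "real^'n^'n"
  assumes "A ** B = mat 1"
  shows "matrix_inv A = B"
proof -
  have "invertible A" using assms invertible_right_inverse by blast
  then have "matrix_inv A ** (A ** B) = B"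
    by (simp add: matrix_mul_assoc matrix_inv)
  then show ?thesis by (simp add: assms)
qed

lemma matrix_inv_eqI_vec:
  fixes A B :: "real^'n^'n"
  assumes "\<And>x. A *v (B *v x) = x"
  shows "matrix_inv A = B"
  using assms by (intro matrix_inv_eqI) (simp add: matrix_eq flip: matrix_vector_mul_assoc)

lemma invertible_matrix_inv:
  fixes A :: "real^'n^'n"
  assumes "invertible A"
  shows "invertible (matrix_inv A)"
  using matrix_inv[OF assms] invertible_def by blast

lemma positive_definite_invertible:
  assumes "positive_definite A"
  shows "invertible A"
proof -
  have "x = 0" if "A *v x = 0" for x
    using assms that by (metis inner_zero_right less_irrefl positive_definite_def)
  then show ?thesis
    by (simp add: invertible_left_inverse matrix_left_invertible_ker)
qed

lemma positive_definite_inner_nonneg: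
  assumes "positive_definite A"
  shows "0 \<le> x \<bullet> (A *v x)"
  using assms by (cases "x = 0") (auto simp: positive_definite_def less_imp_le)

text \<open>A rectangular \<open>P\<close> is allowed so that the result also covers Gram matrices
  of matrices of full column rank.\<close>

lemma positive_definite_congruence:
  fixes A :: "real^'n^'n" and P :: "real^'m^'n"
  assumes A: "positive_definite A" and P: "\<And>x. P *v x = 0 \<Longrightarrow> x = 0"
  shows "positive_definite (transpose P ** A ** P)"
proof -
  have "x \<bullet> ((transpose P ** A ** P) *v x) = (P *v x) \<bullet> (A *v (P *v x))" for x
    using transpose_mult_inner[of P "A *v (P *v x)" x]
    by (simp add: inner_commute flip: matrix_vector_mul_assoc del: transpose_matrix_vector)
  moreover have "transpose (transpose P ** A ** P) = transpose P ** A ** P"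
    using A by (simp add: matrix_transpose_mul matrix_mul_assoc positive_definite_def)
  ultimately show ?thesis
    using A P by (auto simp: positive_definite_def)
qed

text \<open>Congruence by the inverse turns \<open>A\<close> into the transpose of its inverse;
  being positive definite, this is symmetric and hence the inverse itself.\<close>

lemma positive_definite_matrix_inv:
  assumes "positive_definite A"
  shows "positive_definite (matrix_inv A)"
proof -
  have inv: "invertible A" using assms by (rule positive_definite_invertible)
  have "positive_definite (transpose (matrix_inv A) ** A ** matrix_inv A)"
    using assms by (rule positive_definite_congruence) (metis inv matrix_inv_mult_vec(1) matrix_vector_mult_0_right)
  moreover have "transpose (matrix_inv A) ** A ** matrix_inv A = transpose (matrix_inv A)"
    by (simp add: matrix_inv inv flip: matrix_mul_assoc)
  moreover from calculation have "transpose (matrix_inv A) = matrix_inv A"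
    by (metis positive_definite_def transpose_transpose)
  ultimately show ?thesis by simp
qed

lemma mat_inv_sqrt:
  assumes "positive_definite A"
  shows transpose_mat_inv_sqrt: "transpose (mat_inv_sqrt A) = mat_inv_sqrt A"
    and mat_inv_sqrt_square: "mat_inv_sqrt A ** mat_inv_sqrt A = matrix_inv A"
    and invertible_mat_inv_sqrt: "invertible (mat_inv_sqrt A)"
proof -
  define B where "B = mat_sqrt A"
  have B: "transpose B = B" "B ** B = A" using mat_sqrt[OF assms] by (auto simp: B_def)
  have "(matrix_inv A ** B) ** B = mat 1"
    using positive_definite_invertible[OF assms] by (simp add: matrix_inv B(2) flip: matrix_mul_assoc)
  then have inv: "invertible B" using invertible_left_inverse by blast
  then show "invertible (mat_inv_sqrt A)"
    by (simp add: mat_inv_sqrt_def invertible_matrix_inv flip: B_def)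
  have "A *v (matrix_inv B *v (matrix_inv B *v x)) = x" for x
    using inv by (simp add: B(2)[symmetric] flip: matrix_vector_mul_assoc)
  then show "mat_inv_sqrt A ** mat_inv_sqrt A = matrix_inv A"
    using matrix_inv_eqI_vec[of A "matrix_inv B ** matrix_inv B"]
    by (simp add: mat_inv_sqrt_def matrix_vector_mul_assoc flip: B_def)
  have "matrix_inv B = transpose (matrix_inv B)"
    using inv B(1) by (intro matrix_inv_eqI)
      (metis matrix_inv_left matrix_transpose_mul transpose_mat)
  then show "transpose (mat_inv_sqrt A) = mat_inv_sqrt A"
    by (simp add: mat_inv_sqrt_def flip: B_def)
qed

text \<open>This removes the square roots from the statistics: two half powers meet across the inner
  product.\<close>

lemma mat_inv_sqrt_inner:
  assumes "positive_definite A"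
  shows "(mat_inv_sqrt A *v x) \<bullet> (mat_inv_sqrt A *v y) = x \<bullet> (matrix_inv A *v y)"
  by (simp add: symmetric_mult_inner mat_inv_sqrt[OF assms] matrix_vector_mul_assoc)

lemma matrix_inv_congruence:
  fixes P M :: "real^'n^'n"
  assumes "invertible P" "invertible M"
  shows "transpose P *v (matrix_inv (P ** M ** transpose P) *v (P *v x)) = matrix_inv M *v x"
proof -
  have "invertible (P ** M ** transpose P)"
    using assms by (intro invertible_mult transpose_invertible)
  then have "P *v (M *v (transpose P *v (matrix_inv (P ** M ** transpose P) *v (P *v x)))) = P *v x"
    by (simp add: matrix_vector_mul_assoc matrix_mul_assoc matrix_inv del: transpose_matrix_vector)
  then show ?thesis
    using assms by (metis matrix_inv_mult_vec(2))
qed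

lemma matrix_inv_congruence_inner:
  fixes P M :: "real^'n^'n"
  assumes "invertible P" "invertible M"
  shows "(P *v x) \<bullet> (matrix_inv (P ** M ** transpose P) *v (P *v y)) = x \<bullet> (matrix_inv M *v y)"
  using matrix_inv_congruence[OF assms, of y] transpose_mult_inner[of P _ x]
  by (metis inner_commute)

text \<open>Here \<open>A' A\<close> is the scalar \<open>a \<bullet> a\<close>. For
  \<open>a = 0\<close> both sides are 0, the right one because division by zero gives 0.\<close>

lemma proj_mat_columnvector_inner:
  "z \<bullet> (proj_mat (columnvector a :: real^1^'n) *v z) = (z \<bullet> a)\<^sup>2 / (a \<bullet> a)"
proof (cases "a = 0")
  case True
  then have "(columnvector a :: real^1^'n) = 0" by (simp add: columnvector_def vec_eq_iff)
  then show ?thesis using True by (simp add: proj_mat_def flip: matrix_vector_mul_assoc)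
next
  case False
  define A where "A = (columnvector a :: real^1^'n)"
  have nz: "(\<Sum>i\<in>UNIV. a $ i * a $ i) \<noteq> 0"
    using False inner_eq_zero_iff[of a] by (simp add: inner_vec_def)
  have "matrix_inv (transpose A ** A) = (\<chi> i j. 1 / (a \<bullet> a))"
    using nz
    by (intro matrix_inv_eqI)
      (simp add: A_def columnvector_def matrix_matrix_mult_def transpose_def
        inner_vec_def vec_eq_iff mat_def flip: sum_divide_distrib)
  then have "proj_mat A *v z = A *v ((\<chi> i j. 1 / (a \<bullet> a)) *v (transpose A *v z))"
    by (simp add: proj_mat_def matrix_vector_mul_assoc matrix_mul_assoc
        del: transpose_matrix_vector)
  also have "\<dots> = ((z \<bullet> a) / (a \<bullet> a)) *\<^sub>R a"
    by (simp add: A_def columnvector_def matrix_vector_mult_def transpose_def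
        vec_eq_iff inner_vec_def mult.commute del: transpose_matrix_vector)
  finally show ?thesis by (simp add: A_def power2_eq_square)
qed

text \<open>Least squares: the expression is the squared norm of \<open>z\<close> minus that of
  \<open>z - B *v y\<close>, and the projection of \<open>z\<close> is its best approximation in the
  range of \<open>B\<close>.\<close>

lemma proj_mat_inner_maximum:
  fixes B :: "real^'m^'n"
  assumes B: "\<And>x. B *v x = 0 \<Longrightarrow> x = 0"
  shows proj_mat_inner_ge: "2 * (z \<bullet> (B *v y)) - (B *v y) \<bullet> (B *v y) \<le> z \<bullet> (proj_mat B *v z)"
    and proj_mat_inner_attained:
      "\<exists>y. 2 * (z \<bullet> (B *v y)) - (B *v y) \<bullet> (B *v y) = z \<bullet> (proj_mat B *v z)"
proof -
  have "positive_definite (mat 1 :: real^'n^'n)"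
    by (simp add: positive_definite_def)
  from positive_definite_congruence[OF this B]
  have inv: "invertible (transpose B ** B)"
    by (simp add: positive_definite_invertible)
  \<comment> \<open>The solution of the normal equations, so that \<open>B *v w\<close> is the
    orthogonal projection of \<open>z\<close>.\<close>
  define w where "w = matrix_inv (transpose B ** B) *v (transpose B *v z)"
  have p: "proj_mat B *v z = B *v w"
    by (simp add: proj_mat_def w_def matrix_vector_mul_assoc matrix_mul_assoc del: transpose_matrix_vector)
  have "transpose B *v (B *v w) = transpose B *v z"
    using inv by (simp add: w_def matrix_vector_mul_assoc[of "transpose B" B] del: transpose_matrix_vector)
  then have eq: "z \<bullet> (B *v y) = (B *v w) \<bullet> (B *v y)" for y
    by (metis transpose_mult_inner)
  have "0 \<le> (B *v w - B *v y) \<bullet> (B *v w - B *v y)" by simp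
  then show "2 * (z \<bullet> (B *v y)) - (B *v y) \<bullet> (B *v y) \<le> z \<bullet> (proj_mat B *v z)"
    by (simp add: p eq inner_diff inner_commute)
  show "\<exists>y. 2 * (z \<bullet> (B *v y)) - (B *v y) \<bullet> (B *v y) = z \<bullet> (proj_mat B *v z)"
    by (rule exI[of _ w]) (simp add: p eq)
qed

section \<open>Kronecker products and blocks\<close>

text \<open>In terms of stacked columns this is \<open>vectorize\<close> of the matrix
  \<open>y x'\<close> of rank at most one.\<close>

definition tensor :: "real^'a \<Rightarrow> real^'b \<Rightarrow> real^('a \<times> 'b)" where
  "tensor x y = (\<chi> p. x $ fst p * y $ snd p)"

lemma tensor_linear:
  "tensor (x + x') y = tensor x y + tensor x' y"
  "tensor (r *\<^sub>R x) y = r *\<^sub>R tensor x y"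
  "tensor x (r *\<^sub>R y) = r *\<^sub>R tensor x y"
  by (simp_all add: tensor_def vec_eq_iff algebra_simps)

lemma sum_UNIV_pair:
  "(\<Sum>p\<in>UNIV. f p) = (\<Sum>i\<in>UNIV. \<Sum>j\<in>UNIV. f (i, j))"
  by (simp add: sum.cartesian_product flip: UNIV_Times_UNIV)

lemma kron_mult_tensor: "(A \<otimes>\<^sub>K B) *v tensor x y = tensor (A *v x) (B *v y)"
  by (simp add: kron_def tensor_def matrix_vector_mult_def vec_eq_iff sum_UNIV_pair sum_product
      mult_ac)

lemma kron_mult: "(A \<otimes>\<^sub>K B) ** (C \<otimes>\<^sub>K D) = (A ** C) \<otimes>\<^sub>K (B ** D)"
  by (simp add: kron_def matrix_matrix_mult_def vec_eq_iff sum_UNIV_pair sum_product mult_ac)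

lemma kron_mat_1: "(mat 1 :: real^'a^'a) \<otimes>\<^sub>K (mat 1 :: real^'b^'b) = mat 1"
  by (auto simp: kron_def mat_def vec_eq_iff)

lemma transpose_kron: "transpose (A \<otimes>\<^sub>K B) = transpose A \<otimes>\<^sub>K transpose B"
  by (simp add: kron_def transpose_def vec_eq_iff)

lemma vectorize_mult: "vectorize (G ** R ** transpose h) = (h \<otimes>\<^sub>K G) *v vectorize R"
  by (simp add: vectorize_def kron_def matrix_matrix_mult_def matrix_vector_mult_def transpose_def
      vec_eq_iff sum_UNIV_pair sum_distrib_left sum_distrib_right mult_ac)

lemma invertible_kron:
  fixes A :: "real^'a^'a" and B :: "real^'b^'b"
  assumes "invertible A" "invertible B"
  shows "invertible (A \<otimes>\<^sub>K B)"
proof -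
  have "(A \<otimes>\<^sub>K B) ** (matrix_inv A \<otimes>\<^sub>K matrix_inv B) = mat 1"
    by (simp add: kron_mult matrix_inv assms kron_mat_1)
  then show ?thesis using invertible_right_inverse by blast
qed

text \<open>The index type \<open>1 \<times> 'b\<close> has a trivial first component; reading
  \<open>y\<close> at \<open>(1, i)\<close> identifies it with a vector over
  \<open>'b\<close>.\<close>

lemma kron_columnvector_mult:
  "((columnvector x :: real^1^'a) \<otimes>\<^sub>K (mat 1 :: real^'b^'b)) *v y = tensor x (\<chi> i. y $ (1, i))"
  by (simp add: kron_def tensor_def matrix_vector_mult_def vec_eq_iff sum_UNIV_pair columnvector_def
      mat_def if_distrib if_distribR sum.delta cong: if_cong)

section \<open>Blocks as restrictions of bilinear forms\<close>

lemma tensor_axis_inner: "tensor (axis i 1) y \<bullet> z = y \<bullet> (\<chi> p. z $ (i, p))"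
proof -
  have "tensor (axis i 1) y \<bullet> z = (\<Sum>j\<in>UNIV. if j = i then (\<Sum>p\<in>UNIV. y $ p * z $ (i, p)) else 0)"
    unfolding inner_vec_def sum_UNIV_pair
    by (intro sum.cong) (auto simp: tensor_def axis_def)
  then show ?thesis by (simp add: inner_vec_def)
qed

text \<open>Placing vectors in blocks \<open>i\<close> and \<open>j\<close> expresses a block
  through the whole matrix, so its transformation can be read off from the action of
  \<open>K\<close> on such tensors.\<close>

lemma block_inner:
  "y \<bullet> (block i j M *v z) = tensor (axis i 1) y \<bullet> (M *v tensor (axis j 1) z)"
proof -
  have "(M *v tensor (axis j 1) z) $ q = (block i j M *v z) $ p" if "q = (i, p)" for p q
    using tensor_axis_inner[of j z "M $ (i, p)"] that
    by (simp add: matrix_vector_mul_component inner_commute block_def)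
  then show ?thesis by (simp add: tensor_axis_inner)
qed

lemma positive_definite_block:
  fixes M :: "real^(2 \<times> 'b::finite)^(2 \<times> 'b)"
  assumes "positive_definite M"
  shows "positive_definite (block i i M)"
proof -
  have "tensor (axis i 1) x \<noteq> 0" if "x \<noteq> 0" for x :: "real^'b"
  proof
    assume "tensor (axis i 1) x = 0"
    then have "tensor (axis i 1) x $ (i, p) = 0" for p by simp
    then show False using that by (simp add: tensor_def vec_eq_iff)
  qed
  then have "0 < x \<bullet> (block i i M *v x)" if "x \<noteq> 0" for x
    using assms that unfolding block_inner by (simp add: positive_definite_def)
  moreover have "transpose (block i i M) = block i i (transpose M)"
    by (simp add: block_def transpose_def vec_eq_iff)
  ultimately show ?thesis
    using assms by (simp add: positive_definite_def)
qed

lemma hconcat_blocks_mult: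
  "hconcat (block i 1 M) (block i 2 M) *v x = (\<chi> p. (M *v x) $ (i, p))"
proof -
  have "hconcat (block i 1 M) (block i 2 M) = (\<chi> p q. M $ (i, p) $ q)"
    using exhaust_2 by (fastforce simp: hconcat_def block_def vec_eq_iff)
  then show ?thesis by (simp add: matrix_vector_mult_def)
qed

section \<open>The statistics in terms of quadratic forms\<close>

text \<open>The score of the model in \<open>mu\<close> at \<open>mu = 0\<close> under the null
  hypothesis.\<close>

definition score2 :: "'k::finite data \<Rightarrow> real^'k" where
  "score2 d = (\<chi> p. (matrix_inv (snd d) *v vectorize (fst d)) $ (2, p))"

text \<open>The maximum likelihood estimator of \<open>mu\<close> under the null hypothesis.\<close>

definition mle2 :: "'k::finite data \<Rightarrow> real^'k" where
  "mle2 d = matrix_inv (block 2 2 (matrix_inv (snd d))) *v score2 d"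

text \<open>Twice the log-likelihood ratio of mean \<open>p\<close> against mean 0 for positive
  definite \<open>snd d\<close>.\<close>

definition gain :: "'k::finite data \<Rightarrow> real^(2 \<times> 'k) \<Rightarrow> real" where
  "gain d p = 2 * (vectorize (fst d) \<bullet> (matrix_inv (snd d) *v p)) - p \<bullet> (matrix_inv (snd d) *v p)"

lemma AR_stat_eq:
  assumes "positive_definite \<Sigma>"
  shows "AR_stat (R, \<Sigma>) = column 1 R \<bullet> (matrix_inv (block 1 1 \<Sigma>) *v column 1 R)"
  by (simp add: AR_stat_def mat_inv_sqrt_inner positive_definite_block assms)

lemma T_vec_eq: "T_vec (R, \<Sigma>) = mat_inv_sqrt (block 2 2 (matrix_inv \<Sigma>)) *v score2 (R, \<Sigma>)"
  by (simp add: hconcat_blocks_mult score2_def)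

lemma rT_eq:
  assumes "positive_definite \<Sigma>"
  shows "rT (R, \<Sigma>) = score2 (R, \<Sigma>) \<bullet> mle2 (R, \<Sigma>)"
  unfolding rT_def T_vec_eq mle2_def
  by (simp add: mat_inv_sqrt_inner positive_definite_block positive_definite_matrix_inv assms)

text \<open>The half powers in \<open>D\<^sup>-\<^sup>1\<close> and in \<open>T\<close> combine to
  the full inverse, so the projection is onto the line of \<open>C t\<close>. If
  \<open>T = 0\<close>, both sides are 0.\<close>

lemma LM_stat_eq:
  fixes R :: "real^2^'k::finite"
  assumes "positive_definite \<Sigma>"
  defines "t \<equiv> mle2 (R, \<Sigma>)" and "Q \<equiv> matrix_inv (block 1 1 \<Sigma>)"
  shows "LM_stat (R, \<Sigma>) = (column 1 R \<bullet> (Q *v t))\<^sup>2 / (t \<bullet> (Q *v t))"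
proof -
  let ?M = "block 2 2 (matrix_inv \<Sigma>)"
  have "positive_definite ?M"
    by (intro positive_definite_block positive_definite_matrix_inv assms)
  then have "matrix_inv (D_mat (R, \<Sigma>)) *v T_vec (R, \<Sigma>) = t"
    unfolding T_vec_eq
    by (simp add: matrix_vector_mul_assoc mat_inv_sqrt_square t_def mle2_def
        flip: mat_inv_sqrt_def)
  then show ?thesis
    unfolding LM_stat_def proj_mat_columnvector_inner Q_def
    by (simp add: mat_inv_sqrt_inner positive_definite_block assms)
qed

lemma continuous_gain: "continuous_on UNIV (gain d)"
  unfolding gain_def by (intro continuous_intros matrix_vector_mul_bounded_linear linear_continuous_on)

text \<open>The difference of the two sides is the form of \<open>\<Sigma>\<^sup>-\<^sup>1\<close>
  at \<open>v - p\<close>. The bound keeps the supremum over tensors finite.\<close>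

lemma gain_le:
  assumes "positive_definite (snd d)"
  shows "gain d p \<le> vectorize (fst d) \<bullet> (matrix_inv (snd d) *v vectorize (fst d))"
proof -
  define Q v where "Q = matrix_inv (snd d)" and "v = vectorize (fst d)"
  have Q: "positive_definite Q" unfolding Q_def by (intro positive_definite_matrix_inv assms)
  have "0 \<le> (v - p) \<bullet> (Q *v (v - p))" using Q by (rule positive_definite_inner_nonneg)
  moreover have "v \<bullet> (Q *v p) = p \<bullet> (Q *v v)"
    using Q symmetric_mult_inner[of Q v p] by (simp add: positive_definite_def inner_commute)
  ultimately show ?thesis
    by (simp add: gain_def inner_diff algebra_simps flip: Q_def v_def)
qed

text \<open>The vectors \<open>a\<^sub>\<Delta> \<otimes> y\<close> represent all rank-one tensors except the \<open>e\<^sub>1 \<otimes> y\<close>, which are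
  limits of multiples of them.\<close>

lemma gain_tensor_le:
  fixes d :: "'k::finite data"
  assumes le: "\<And>\<Delta> y. gain d (tensor (a_vec \<Delta>) y) \<le> c"
  shows "gain d (tensor x y) \<le> c"
proof -
  have ne: "gain d (tensor x y) \<le> c" if "x $ 2 \<noteq> 0" for x
  proof -
    \<comment> \<open>Scaling the second coordinate of \<open>x\<close> to 1 moves the factor into
      \<open>y\<close>.\<close>
    have "tensor x y = tensor (a_vec (x $ 1 / x $ 2)) (x $ 2 *\<^sub>R y)"
      using that by (simp add: tensor_def a_vec_def vec_eq_iff split_paired_All forall_2)
    then show ?thesis using le by simp
  qed
  show ?thesis
  proof (cases "x $ 2 = 0")
    case True
    \<comment> \<open>The vanishing second coordinate of \<open>x\<close> is moved to
      \<open>s\<close>; the bound holds for \<open>s \<noteq> 0\<close> and passes to the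
      limit.\<close>
    define h where "h s = gain d (tensor x y + s *\<^sub>R tensor (axis 2 1) y)" for s
    have "isCont h 0"
      unfolding h_def
      by (intro continuous_intros continuous_within_compose3[OF continuous_gain[unfolded continuous_on_eq_continuous_within, rule_format]]) auto
    then have "(h \<longlongrightarrow> h 0) (at 0)" by (simp add: isCont_def)
    moreover have "h s \<le> c" if "s \<noteq> 0" for s
      using ne[of "x + s *\<^sub>R axis 2 1"] that True by (simp add: h_def tensor_linear axis_def)
    ultimately have "h 0 \<le> c"
      by (intro tendsto_upperbound[of h "h 0" "at 0"]) (auto simp: eventually_at_filter)
    then show ?thesis by (simp add: h_def)
  qed (rule ne)
qed

text \<open>For each \<Delta> the projection form is the maximum of \<open>gain\<close> over
  \<open>y\<close>. Passing to all tensors matters because \<open>h\<close> can send some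
  \<open>a_vec \<Delta>\<close> to a vector with second coordinate 0.\<close>

lemma LR_stat_eq:
  fixes R :: "real^2^'k::finite"
  assumes "positive_definite \<Sigma>"
  shows "LR_stat (R, \<Sigma>) = (SUP (x, y). gain (R, \<Sigma>) (tensor x y)) - rT (R, \<Sigma>)"
proof -
  define W where "W = mat_inv_sqrt \<Sigma>"
  define B where "B \<Delta> = W ** ((columnvector (a_vec \<Delta>) :: real^1^2) \<otimes>\<^sub>K (mat 1 :: real^'k^'k))" for \<Delta>
  define f where "f \<Delta> = vectorize R \<bullet> (W *v (proj_mat (B \<Delta>) *v (W *v vectorize R)))" for \<Delta>
  note W = mat_inv_sqrt[OF assms, folded W_def]
  have Wi: "(W *v x) \<bullet> (W *v y) = x \<bullet> (matrix_inv \<Sigma> *v y)" for x y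
    by (simp add: W_def mat_inv_sqrt_inner assms)
  have f: "f \<Delta> = (W *v vectorize R) \<bullet> (proj_mat (B \<Delta>) *v (W *v vectorize R))" for \<Delta>
    by (simp add: f_def symmetric_mult_inner W)
  have B: "B \<Delta> *v y = W *v tensor (a_vec \<Delta>) (\<chi> i. y $ (1, i))" for \<Delta> y
    by (simp add: B_def kron_columnvector_mult flip: matrix_vector_mul_assoc)
  have B0: "y = 0" if "B \<Delta> *v y = 0" for \<Delta> y
  proof -
    have "tensor (a_vec \<Delta>) (\<chi> i. y $ (1, i)) = 0"
      using that W(3) unfolding B by (metis matrix_inv_mult_vec(2) matrix_vector_mult_0_right)
    \<comment> \<open>The second coordinate of \<open>a_vec \<Delta>\<close> is 1, so the second
      block returns \<open>y\<close>: full column rank for every \<Delta>.\<close>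
    then have "tensor (a_vec \<Delta>) (\<chi> i. y $ (1, i)) $ (2, i) = 0" for i by simp
    then have "y $ (j, i) = 0" for i and j :: 1
      by (simp add: tensor_def a_vec_def num1_eq1[of j])
    then show ?thesis by (simp add: vec_eq_iff)
  qed
  have gain: "2 * ((W *v vectorize R) \<bullet> (B \<Delta> *v y)) - (B \<Delta> *v y) \<bullet> (B \<Delta> *v y)
      = gain (R, \<Sigma>) (tensor (a_vec \<Delta>) (\<chi> i. y $ (1, i)))" for \<Delta> y
    by (simp add: B Wi gain_def)
  have ge: "gain (R, \<Sigma>) (tensor (a_vec \<Delta>) y) \<le> f \<Delta>" for \<Delta> y
  proof -
    \<comment> \<open>The inner vector lifts \<open>y\<close> to the index type
      \<open>1 \<times> 'k\<close>, to match the columns of \<open>B \<Delta>\<close>.\<close>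
    have "gain (R, \<Sigma>) (tensor (a_vec \<Delta>) (\<chi> i. (\<chi> p. y $ snd p) $ (1 :: 1, i))) \<le> f \<Delta>"
      unfolding f gain[symmetric] by (rule proj_mat_inner_ge) (rule B0)
    then show ?thesis by simp
  qed
  have att: "\<exists>y. f \<Delta> = gain (R, \<Sigma>) (tensor (a_vec \<Delta>) y)" for \<Delta>
  proof -
    have "\<exists>y. 2 * ((W *v vectorize R) \<bullet> (B \<Delta> *v y)) - (B \<Delta> *v y) \<bullet> (B \<Delta> *v y) = f \<Delta>"
      unfolding f by (rule proj_mat_inner_attained) (rule B0)
    then show ?thesis unfolding gain by (metis (no_types))
  qed
  have "(SUP \<Delta>. f \<Delta>) = (SUP (x, y). gain (R, \<Sigma>) (tensor x y))"
  proof (rule cSup_eq_non_empty)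
    have bdd: "bdd_above (range (\<lambda>(x, y). gain (R, \<Sigma>) (tensor x y)))"
      using gain_le[of "(R, \<Sigma>)"] assms by (auto intro!: bdd_aboveI)
    show "z \<le> (SUP (x, y). gain (R, \<Sigma>) (tensor x y))" if "z \<in> range f" for z
    proof -
      from that obtain \<Delta> where "z = f \<Delta>" by blast
      moreover from att[of \<Delta>] obtain y where "f \<Delta> = gain (R, \<Sigma>) (tensor (a_vec \<Delta>) y)" ..
      ultimately have "z = gain (R, \<Sigma>) (tensor (a_vec \<Delta>) y)" by simp
      then show ?thesis using cSUP_upper[OF _ bdd, of "(a_vec \<Delta>, y)"] by simp
    qed
    show "(SUP (x, y). gain (R, \<Sigma>) (tensor x y)) \<le> c" if c: "\<And>z. z \<in> range f \<Longrightarrow> z \<le> c" for c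
    proof -
      have "gain (R, \<Sigma>) (tensor x y) \<le> c" for x y
        by (rule gain_tensor_le) (use ge c order_trans in blast)
      then show ?thesis by (intro cSUP_least) auto
    qed
  qed simp
  then show ?thesis by (simp add: f_def B_def W_def rT_def)
qed

section \<open>The group action\<close>

locale group_action =
  fixes R :: "real^2^'k::finite" and \<Sigma> :: "real^(2 \<times> 'k)^(2 \<times> 'k)"
    and G :: "real^'k^'k" and h :: "real^2^2"
  assumes pd: "positive_definite \<Sigma>" and G: "invertible G"
    and h: "invertible h" and h12: "h $ 1 $ 2 = 0"
begin

abbreviation "K \<equiv> h \<otimes>\<^sub>K G"
abbreviation "R' \<equiv> G ** R ** transpose h"
abbreviation "\<Sigma>' \<equiv> K ** \<Sigma> ** transpose K"

lemma act_eq: "act (G, h) (R, \<Sigma>) = (R', \<Sigma>')"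
  by (simp add: transpose_kron)

lemma h_diag: "h $ 1 $ 1 \<noteq> 0" "h $ 2 $ 2 \<noteq> 0"
  using h h12 by (auto simp: invertible_det_nz det_2)

lemma K: "invertible K"
  using h G by (rule invertible_kron)

lemma pd': "positive_definite \<Sigma>'"
proof -
  have "transpose K *v x = 0 \<Longrightarrow> x = 0" for x
    by (metis K matrix_inv_mult_vec(2) matrix_vector_mult_0_right transpose_invertible)
  then show ?thesis
    using positive_definite_congruence[OF pd, of "transpose K"] by simp
qed

lemma inv_\<Sigma>'_inner: "(K *v x) \<bullet> (matrix_inv \<Sigma>' *v (K *v y)) = x \<bullet> (matrix_inv \<Sigma> *v y)"
  by (rule matrix_inv_congruence_inner[OF K positive_definite_invertible[OF pd]])

lemma gain_act: "gain (R', \<Sigma>') (tensor (h *v x) (G *v y)) = gain (R, \<Sigma>) (tensor x y)"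
  unfolding gain_def by (simp add: vectorize_mult inv_\<Sigma>'_inner flip: kron_mult_tensor)

text \<open>Reindexing by the surjection \<open>(x, y) \<mapsto> (h x, G y)\<close>, under which
  \<open>gain_act\<close> identifies the two families.\<close>

lemma SUP_gain_act:
  "(SUP (x, y). gain (R', \<Sigma>') (tensor x y)) = (SUP (x, y). gain (R, \<Sigma>) (tensor x y))"
proof -
  define m F where "m = map_prod ((*v) h) ((*v) G)"
    and "F = (\<lambda>(x, y). gain (R', \<Sigma>') (tensor x y))"
  have "surj m"
    unfolding m_def using h G by (intro map_prod_surj) (metis matrix_inv_mult_vec(1) surjI)+
  then have "(SUP p. F p) = (SUP p. F (m p))"
    using image_image[of F m UNIV] by simp
  then show ?thesis by (simp add: F_def m_def gain_act case_prod_beta)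
qed

text \<open>The congruence on the first block: \<open>h' e1 = h11 e1\<close> since
  \<open>h12 = 0\<close>, so \<open>K'\<close> maps \<open>e1 \<otimes> y\<close> to
  \<open>e1 \<otimes> P1' y\<close>.\<close>

definition "P1 = (h $ 1 $ 1) *\<^sub>R G"
text \<open>The congruence on the second block of the inverse: \<open>h e2 = h22 e2\<close>, so
  \<open>K\<close> maps \<open>e2 \<otimes> P2' y\<close> to \<open>e2 \<otimes> y\<close>.\<close>

definition "P2 = (1 / h $ 2 $ 2) *\<^sub>R transpose (matrix_inv G)"

lemma P1: "invertible P1"
  unfolding P1_def using h_diag G by (simp add: scalar_invertible)

lemma P2: "invertible P2"
  unfolding P2_def using h_diag G
  by (simp add: scalar_invertible transpose_invertible invertible_matrix_inv)

lemma column_act: "column 1 R' = P1 *v column 1 R"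
  by (simp add: P1_def column_def matrix_matrix_mult_def matrix_vector_mult_def transpose_def
      vec_eq_iff sum_2 h12 sum_distrib_left mult_ac)

lemma transpose_K_tensor: "transpose K *v tensor (axis 1 1) y = tensor (axis 1 1) (transpose P1 *v y)"
proof -
  have "transpose h *v axis 1 1 = (h $ 1 $ 1) *\<^sub>R axis 1 1"
    by (simp add: h12 vec_eq_iff forall_2 matrix_vector_mult_def sum_2 transpose_def axis_def
        del: transpose_matrix_vector)
  then show ?thesis
    by (simp add: transpose_kron kron_mult_tensor P1_def tensor_linear transpose_scalar
        scaleR_matrix_vector_assoc[symmetric] del: transpose_matrix_vector)
qed

lemma K_tensor: "K *v tensor (axis 2 1) (transpose P2 *v y) = tensor (axis 2 1) y"
proof -
  have "h *v axis 2 1 = (h $ 2 $ 2) *\<^sub>R axis 2 1"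
    by (simp add: h12 vec_eq_iff forall_2 matrix_vector_mult_def sum_2 axis_def)
  then show ?thesis
    using h_diag G
    by (simp add: kron_mult_tensor P2_def tensor_linear transpose_scalar
        scaleR_matrix_vector_assoc[symmetric] matrix_vector_mult_scaleR del: transpose_matrix_vector)
qed

lemma block_act: "block 1 1 \<Sigma>' = P1 ** block 1 1 \<Sigma> ** transpose P1"
proof (rule matrix_eq_inner)
  fix x y
  have "x \<bullet> (block 1 1 \<Sigma>' *v y)
      = (transpose K *v tensor (axis 1 1) x) \<bullet> (\<Sigma> *v (transpose K *v tensor (axis 1 1) y))"
    by (simp only: block_inner transpose_mult_inner matrix_vector_mul_assoc matrix_mul_assoc)
  also have "\<dots> = (transpose P1 *v x) \<bullet> (block 1 1 \<Sigma> *v (transpose P1 *v y))"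
    by (simp only: transpose_K_tensor block_inner)
  also have "\<dots> = x \<bullet> ((P1 ** block 1 1 \<Sigma> ** transpose P1) *v y)"
    by (simp only: transpose_mult_inner matrix_vector_mul_assoc matrix_mul_assoc)
  finally show "x \<bullet> (block 1 1 \<Sigma>' *v y) = x \<bullet> ((P1 ** block 1 1 \<Sigma> ** transpose P1) *v y)" .
qed

lemma block_inv_act:
  "block 2 2 (matrix_inv \<Sigma>') = P2 ** block 2 2 (matrix_inv \<Sigma>) ** transpose P2"
proof (rule matrix_eq_inner)
  fix x y
  have "x \<bullet> (block 2 2 (matrix_inv \<Sigma>') *v y)
      = tensor (axis 2 1) (transpose P2 *v x) \<bullet> (matrix_inv \<Sigma> *v tensor (axis 2 1) (transpose P2 *v y))"
    by (simp only: block_inner inv_\<Sigma>'_inner flip: K_tensor[of x] K_tensor[of y])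
  also have "\<dots> = x \<bullet> ((P2 ** block 2 2 (matrix_inv \<Sigma>) ** transpose P2) *v y)"
    by (simp only: block_inner[symmetric] transpose_mult_inner matrix_vector_mul_assoc matrix_mul_assoc)
  finally show "x \<bullet> (block 2 2 (matrix_inv \<Sigma>') *v y)
      = x \<bullet> ((P2 ** block 2 2 (matrix_inv \<Sigma>) ** transpose P2) *v y)" .
qed

lemma score2_act: "score2 (R', \<Sigma>') = P2 *v score2 (R, \<Sigma>)"
proof -
  have "y \<bullet> score2 (R', \<Sigma>') = y \<bullet> (P2 *v score2 (R, \<Sigma>))" for y
  proof -
    have "y \<bullet> score2 (R', \<Sigma>')
        = (K *v tensor (axis 2 1) (transpose P2 *v y)) \<bullet> (matrix_inv \<Sigma>' *v (K *v vectorize R))"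
      by (simp only: K_tensor) (simp add: score2_def vectorize_mult tensor_axis_inner)
    also have "\<dots> = (transpose P2 *v y) \<bullet> score2 (R, \<Sigma>)"
      by (simp only: inv_\<Sigma>'_inner score2_def tensor_axis_inner fst_conv snd_conv)
    finally show ?thesis by (simp only: transpose_mult_inner)
  qed
  then show ?thesis by (metis vector_eq_ldot)
qed

lemma block_inv: "invertible (block 2 2 (matrix_inv \<Sigma>))"
  by (intro positive_definite_invertible positive_definite_block positive_definite_matrix_inv pd)

text \<open>The estimator changes by the inverse of \<open>P2'\<close>, which is
  \<open>h22 G\<close>, a multiple of \<open>P1 = h11 G\<close>.\<close>

lemma mle2_act: "mle2 (R', \<Sigma>') = (h $ 2 $ 2 / h $ 1 $ 1) *\<^sub>R (P1 *v mle2 (R, \<Sigma>))"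
proof -
  have "transpose P2 *v mle2 (R', \<Sigma>') = mle2 (R, \<Sigma>)"
    using matrix_inv_congruence[OF P2 block_inv]
    by (simp add: mle2_def block_inv_act score2_act del: transpose_matrix_vector)
  then have m: "mle2 (R, \<Sigma>) = (1 / h $ 2 $ 2) *\<^sub>R (matrix_inv G *v mle2 (R', \<Sigma>'))"
    by (simp add: P2_def transpose_scalar scaleR_matrix_vector_assoc del: transpose_matrix_vector)
  have "P1 *v mle2 (R, \<Sigma>) = (h $ 1 $ 1 / h $ 2 $ 2) *\<^sub>R mle2 (R', \<Sigma>')"
    using G unfolding m by (simp add: P1_def matrix_vector_mult_scaleR scaleR_matrix_vector_assoc[symmetric])
  then show ?thesis using h_diag by simp
qed

lemma rT_act: "rT (R', \<Sigma>') = rT (R, \<Sigma>)"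
  using matrix_inv_congruence_inner[OF P2 block_inv]
  by (simp add: rT_eq pd pd' mle2_def block_inv_act score2_act)

lemma inv_block_act_inner:
  "(P1 *v x) \<bullet> (matrix_inv (block 1 1 \<Sigma>') *v (P1 *v y)) = x \<bullet> (matrix_inv (block 1 1 \<Sigma>) *v y)"
  unfolding block_act
  by (rule matrix_inv_congruence_inner[OF P1 positive_definite_invertible[OF positive_definite_block[OF pd]]])

lemma AR_act: "AR_stat (R', \<Sigma>') = AR_stat (R, \<Sigma>)"
  by (simp add: AR_stat_eq pd pd' column_act inv_block_act_inner)

lemma LR_act: "LR_stat (R', \<Sigma>') = LR_stat (R, \<Sigma>)"
  by (simp add: LR_stat_eq pd pd' rT_act SUP_gain_act del: LR_stat.simps)

text \<open>The quotient in \<open>LM_stat_eq\<close> is homogeneous of degree 0 in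
  \<open>t\<close>, so the nonzero factor from \<open>mle2_act\<close> cancels.\<close>

lemma LM_act: "LM_stat (R', \<Sigma>') = LM_stat (R, \<Sigma>)"
  using h_diag
  by (simp add: LM_stat_eq pd pd' column_act mle2_act matrix_vector_mult_scaleR inv_block_act_inner
      power_mult_distrib power2_eq_square)

end

theorem proposition4:
  fixes R\<^sub>0 :: "real^2^'k::finite"
    and \<Sigma>\<^sub>0 :: "real^(2 \<times> 'k)^(2 \<times> 'k)"
    and g :: "(real^'k^'k) \<times> (real^2^2)"
  assumes "positive_definite \<Sigma>\<^sub>0"
    and "g \<in> GL \<times> GT2"
  shows "positive_definite (snd (act g (R\<^sub>0, \<Sigma>\<^sub>0)))
    \<and> AR_stat (act g (R\<^sub>0, \<Sigma>\<^sub>0)) = AR_stat (R\<^sub>0, \<Sigma>\<^sub>0)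
    \<and> LR_stat (act g (R\<^sub>0, \<Sigma>\<^sub>0)) = LR_stat (R\<^sub>0, \<Sigma>\<^sub>0)
    \<and> (T_vec (R\<^sub>0, \<Sigma>\<^sub>0) \<noteq> 0 \<longrightarrow>
         T_vec (act g (R\<^sub>0, \<Sigma>\<^sub>0)) \<noteq> 0
         \<and> LM_stat (act g (R\<^sub>0, \<Sigma>\<^sub>0)) = LM_stat (R\<^sub>0, \<Sigma>\<^sub>0)
         \<and> QLR_stat (act g (R\<^sub>0, \<Sigma>\<^sub>0)) = QLR_stat (R\<^sub>0, \<Sigma>\<^sub>0))"
proof -
  obtain G h where g: "g = (G, h)" by fastforce
  interpret group_action R\<^sub>0 \<Sigma>\<^sub>0 G h
    using assms by unfold_locales (auto simp: g GL_def GT2_def)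
  \<comment> \<open>\<open>T\<close> itself need not be invariant, but its squared norm
    \<open>rT\<close> is, which settles whether it vanishes.\<close>
  have "T_vec (R', \<Sigma>') \<noteq> 0 \<longleftrightarrow> T_vec (R\<^sub>0, \<Sigma>\<^sub>0) \<noteq> 0"
    using rT_act unfolding rT_def by (metis inner_eq_zero_iff)
  then show ?thesis
    unfolding g act_eq QLR_stat_def snd_conv AR_act LR_act LM_act rT_act using pd' by blast
qed

end
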